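(* Let $n_d\ge 1$, let $S_1,\dots,S_{n_d}>0$, and let $\underline{P_0}\le\overline{P_0}$ be real numbers. For $S>0$ define $\mathcal{X}(S,\underline{P_0},\overline{P_0})=\{(P,Q)\in\mathbb{R}^2: S\underline{P_0}\le P\le S\overline{P_0},\ Q^2\le S^2-P^2\}$. Then $$\bigoplus_{i=1}^{n_d}\mathcal{X}(S_i,\underline{P_0},\overline{P_0})=\mathcal{X}\Big(\sum_{i=1}^{n_d}S_i,\underline{P_0},\overline{P_0}\Big).$$
   Context: $\oplus$ denotes the Minkowski sum $A\oplus B=\{a+b: a\in A, b\in B\}$. The set $\mathcal{X}(S,\underline{P},\overline{P})$ is the feasible real/reactive power set of an inverter with apparent power rating $S$ and normalized real power bounds $\underline{P},\overline{P}$. *)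

theory Defs
  imports "HOL-Analysis.Analysis"
begin

definition feasible_set :: "real \<Rightarrow> real \<Rightarrow> real \<Rightarrow> (real \<times> real) set" where
  "feasible_set S Plo Phi = {(P, Q). S * Plo \<le> P \<and> P \<le> S * Phi \<and> Q\<^sup>2 \<le> S\<^sup>2 - P\<^sup>2}"

text \<open>Binary Minkowski sum.\<close>
definition minkowski_sum :: "'a::ab_group_add set \<Rightarrow> 'a set \<Rightarrow> 'a set" where
  "minkowski_sum A B = {a + b | a b. a \<in> A \<and> b \<in> B}"

text \<open>Iterated Minkowski sum of A 1, ..., A n (n \<ge> 1).\<close>
fun minkowski_sum_n :: "(nat \<Rightarrow> 'a::ab_group_add set) \<Rightarrow> nat \<Rightarrow> 'a set" where
  "minkowski_sum_n A 0 = {0}"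
| "minkowski_sum_n A (Suc n) = minkowski_sum (minkowski_sum_n A n) (A (Suc n))"

end

theory Submission
  imports Defs
begin

(* X(S, Plo, Phi) is the intersection of a vertical strip with the disc of radius S, so it is
   convex and equals the dilate S X(1, Plo, Phi). For a convex set C and a, b \<ge> 0 one has
   a C \<oplus> b C = (a + b) C, because a x + b y is (a + b) times a convex combination of x and y.
   Induction over the number of inverters gives the theorem. *)

lemma feasible_set_eq_strip_Int_cball:
  "feasible_set S Plo Phi = fst -` {S * Plo..S * Phi} \<inter> cball 0 \<bar>S\<bar>"
proof -
  have "norm (P, Q) \<le> \<bar>S\<bar> \<longleftrightarrow> Q\<^sup>2 \<le> S\<^sup>2 - P\<^sup>2" for P Q :: real
  proof -
    have "norm (P, Q) \<le> \<bar>S\<bar> \<longleftrightarrow> sqrt (P\<^sup>2 + Q\<^sup>2) \<le> sqrt (S\<^sup>2)"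
      by (simp add: norm_Pair)
    then show ?thesis
      by (simp only: real_sqrt_le_iff) linarith
  qed
  then show ?thesis
    by (auto simp: feasible_set_def)
qed

lemma convex_feasible_set: "convex (feasible_set S Plo Phi)"
  unfolding feasible_set_eq_strip_Int_cball
  by (intro convex_Int convex_linear_vimage linear_fst) auto

lemma scaleR_image_feasible_set_subset:
  assumes "0 \<le> t"
  shows "(*\<^sub>R) t ` feasible_set S Plo Phi \<subseteq> feasible_set (t * S) Plo Phi"
proof (rule image_subsetI)
  fix z assume "z \<in> feasible_set S Plo Phi"
  then have "S * Plo \<le> fst z" "fst z \<le> S * Phi" "norm z \<le> \<bar>S\<bar>"
    by (auto simp: feasible_set_eq_strip_Int_cball)
  with assms show "t *\<^sub>R z \<in> feasible_set (t * S) Plo Phi"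
    by (auto simp: feasible_set_eq_strip_Int_cball abs_mult mult.assoc intro: mult_left_mono)
qed

lemma scaleR_image_feasible_set:
  assumes "0 < t"
  shows "(*\<^sub>R) t ` feasible_set S Plo Phi = feasible_set (t * S) Plo Phi"
proof
  show "(*\<^sub>R) t ` feasible_set S Plo Phi \<subseteq> feasible_set (t * S) Plo Phi"
    using assms by (simp add: scaleR_image_feasible_set_subset)
  have "(*\<^sub>R) (inverse t) ` feasible_set (t * S) Plo Phi \<subseteq> feasible_set S Plo Phi"
    using assms scaleR_image_feasible_set_subset [of "inverse t" "t * S"]
    by (simp add: mult.assoc [symmetric])
  then have "(*\<^sub>R) t ` (*\<^sub>R) (inverse t) ` feasible_set (t * S) Plo Phi
      \<subseteq> (*\<^sub>R) t ` feasible_set S Plo Phi"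
    by (rule image_mono)
  then show "feasible_set (t * S) Plo Phi \<subseteq> (*\<^sub>R) t ` feasible_set S Plo Phi"
    using assms by (simp add: image_image)
qed

lemma minkowski_sum_zero_left: "minkowski_sum {0} A = A"
  by (auto simp: minkowski_sum_def)

lemma minkowski_sum_scaleR_convex:
  fixes C :: "'a::real_vector set"
  assumes "convex C" "0 \<le> a" "0 \<le> b"
  shows "minkowski_sum ((*\<^sub>R) a ` C) ((*\<^sub>R) b ` C) = (*\<^sub>R) (a + b) ` C"
proof
  show "(*\<^sub>R) (a + b) ` C \<subseteq> minkowski_sum ((*\<^sub>R) a ` C) ((*\<^sub>R) b ` C)"
    by (auto simp: minkowski_sum_def scaleR_add_left)
next
  show "minkowski_sum ((*\<^sub>R) a ` C) ((*\<^sub>R) b ` C) \<subseteq> (*\<^sub>R) (a + b) ` C"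
  proof (clarsimp simp: minkowski_sum_def)
    fix x y assume "x \<in> C" "y \<in> C"
    show "a *\<^sub>R x + b *\<^sub>R y \<in> (*\<^sub>R) (a + b) ` C"
    proof (cases "a + b = 0")
      case True
      then have "a = 0" "b = 0" using assms by auto
      then show ?thesis using \<open>x \<in> C\<close> by auto
    next
      case False
      let ?z = "(a / (a + b)) *\<^sub>R x + (b / (a + b)) *\<^sub>R y"
      have "?z \<in> C"
        using assms \<open>x \<in> C\<close> \<open>y \<in> C\<close> False
        by (intro convexD) (auto simp: add_divide_distrib [symmetric])
      moreover have "a *\<^sub>R x + b *\<^sub>R y = (a + b) *\<^sub>R ?z"
        using False by (simp add: scaleR_add_right)
      ultimately show ?thesis by blast
    qed
  qed
qed

lemma minkowski_sum_n_scaleR_convex: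
  fixes C :: "'a::real_vector set"
  assumes "convex C" "1 \<le> n"
    and "\<And>i. i \<in> {1..n} \<Longrightarrow> 0 \<le> c i"
    and "\<And>i. i \<in> {1..n} \<Longrightarrow> A i = (*\<^sub>R) (c i) ` C"
  shows "minkowski_sum_n A n = (*\<^sub>R) (\<Sum>i=1..n. c i) ` C"
  using assms(2-4)
proof (induction n rule: nat_induct_at_least)
  case base
  then show ?case by (simp add: minkowski_sum_zero_left)
next
  case (Suc n)
  then have "minkowski_sum_n A n = (*\<^sub>R) (\<Sum>i=1..n. c i) ` C"
    by simp
  moreover have "0 \<le> (\<Sum>i=1..n. c i)"
    using Suc.prems by (intro sum_nonneg) simp
  ultimately show ?case
    using Suc.prems minkowski_sum_scaleR_convex [OF assms(1)] by (simp add: add.commute)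
qed

theorem theorem1:
  fixes nd :: nat and S :: "nat \<Rightarrow> real" and Plo Phi :: real
  assumes "nd \<ge> 1"
    and "\<And>i. i \<in> {1..nd} \<Longrightarrow> S i > 0"
    and "Plo \<le> Phi"
  shows "minkowski_sum_n (\<lambda>i. feasible_set (S i) Plo Phi) nd
         = feasible_set (\<Sum>i=1..nd. S i) Plo Phi"
proof -
  have dilate: "feasible_set (S i) Plo Phi = (*\<^sub>R) (S i) ` feasible_set 1 Plo Phi"
    if "i \<in> {1..nd}" for i
    using scaleR_image_feasible_set [OF assms(2) [OF that], of 1] by simp
  have "minkowski_sum_n (\<lambda>i. feasible_set (S i) Plo Phi) nd
      = (*\<^sub>R) (\<Sum>i=1..nd. S i) ` feasible_set 1 Plo Phi"
    using assms(1,2) dilate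
    by (intro minkowski_sum_n_scaleR_convex convex_feasible_set) (auto intro: less_imp_le)
  also have "\<dots> = feasible_set (\<Sum>i=1..nd. S i) Plo Phi"
  proof -
    have "0 < (\<Sum>i=1..nd. S i)"
      using assms(1,2) by (intro sum_pos) auto
    then show ?thesis
      using scaleR_image_feasible_set [of "\<Sum>i=1..nd. S i" 1] by simp
  qed
  finally show ?thesis .
qed

end
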